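(* The expected value of $\pi_1$ for prime parking functions $\pi\in \mathrm{PPF}_{n+1}$ (chosen uniformly at random) is \[ \mathbb{E} [\pi_1 \mid \pi \in \mathrm{PPF}_{n+1}]=\frac{1}{2}\left(n+3-\frac{n!}{n^n}\sum_{s=0}^n\frac{n^{s}}{s!}\right).\]
   Context: A (classical) parking function of length $n$ is a sequence $\pi=(\pi_1,\dots,\pi_n)$ of positive integers whose increasing rearrangement $\lambda_1\le\cdots\le\lambda_n$ satisfies $\lambda_i\le i$ for all $i$; $\mathrm{PF}_n$ denotes the set of such. A parking function $\pi$ of length $n+1$ is a prime parking function if removing any instance of 1 from $\pi$ yields a parking function of length $n$; $\mathrm{PPF}_{n+1}$ denotes the set of prime parking functions of length $n+1$, and $|\mathrm{PPF}_{n+1}|=n^n$. *)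

theory Defs
  imports "HOL-Probability.Probability"
begin

definition parking_functions :: "nat \<Rightarrow> nat list set" where
  "parking_functions n =
     {\<pi>. length \<pi> = n \<and> (\<forall>x\<in>set \<pi>. 1 \<le> x) \<and> (\<forall>i<n. sort \<pi> ! i \<le> i + 1)}"

definition remove_nth :: "nat \<Rightarrow> 'a list \<Rightarrow> 'a list" where
  "remove_nth i xs = take i xs @ drop (Suc i) xs"

text \<open>Only positive lengths are meaningful, as the shortened list has length \<open>m - 1\<close>.\<close>

definition prime_parking_functions :: "nat \<Rightarrow> nat list set" where
  "prime_parking_functions m =
     {\<pi> \<in> parking_functions m.
        0 < m \<and> (\<forall>i<m. \<pi> ! i = 1 \<longrightarrow> remove_nth i \<pi> \<in> parking_functions (m - 1))}"

end

theory Submission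
  imports Defs
begin

text \<open>
  Generalise parking functions by a parameter \<open>b\<close>: functions on an \<open>m\<close>-element set for which more
  than \<open>k - b\<close> values are at most \<open>k\<close>, for every \<open>k < b + m\<close>. Deleting the set \<open>J\<close> of arguments
  with value 1 and lowering the other values by 1 gives an arbitrary function of the same kind
  with parameter \<open>b + |J| - 1\<close> on \<open>m - |J|\<close> elements. In the resulting recurrences \<open>b + m\<close> drops by
  exactly 1 whatever \<open>J\<close> is, so binomial sums solve them: there are \<open>b (b + m)\<^sup>m\<^sup>-\<^sup>1\<close> such functions,
  and with \<open>m = n + 1\<close> and \<open>x = b + m\<close> the values at a fixed argument sum to
  \<open>b/2 (x\<^sup>n (x + 1) - \<Sum>s\<le>n. n!/s! x\<^sup>s)\<close>. Prime parking functions are the case \<open>b = 0\<close> with the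
  constraint at \<open>k = 0\<close> dropped. One more application of the recurrence to them differs from the
  formula at \<open>b = 0\<close>, which vanishes, only by lacking the term for \<open>J = {}\<close>, which
  therefore determines both their number \<open>n\<^sup>n\<close> and the sum of their first entries.
\<close>

section \<open>Binomial sums and the truncated exponential\<close>

lemma sum_Pow_card:
  fixes g :: "nat \<Rightarrow> real"
  assumes "finite B"
  shows "(\<Sum>J\<in>Pow B. g (card J)) = (\<Sum>j\<le>card B. real (card B choose j) * g j)"
proof -
  have "(\<Sum>J\<in>Pow B. g (card J)) = (\<Sum>j\<le>card B. \<Sum>J\<in>{J\<in>Pow B. card J = j}. g (card J))"
    using assms by (intro sum.group[symmetric]) (auto intro: card_mono)
  also have "\<dots> = (\<Sum>j\<le>card B. real (card B choose j) * g j)"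
    using n_subsets[OF assms] by (intro sum.cong) auto
  finally show ?thesis .
qed

text \<open>The binomial theorem plus absorption; at \<open>n = 0\<close> the factor
  \<open>real n\<close> takes care of the exponent \<open>n - 1\<close>.\<close>

lemma sum_binomial_linear:
  fixes c x :: real
  shows "(\<Sum>j\<le>n. real (n choose j) * (c + real j) * x ^ (n - j))
       = c * (x + 1) ^ n + real n * (x + 1) ^ (n - 1)"
proof -
  have 1: "(\<Sum>j\<le>n. real (n choose j) * x ^ (n - j)) = (x + 1) ^ n" for n
    using binomial_ring[of 1 x n] by (simp add: add.commute)
  have 2: "(\<Sum>j\<le>n. real j * real (n choose j) * x ^ (n - j)) = real n * (x + 1) ^ (n - 1)"
  proof (cases n)
    case (Suc m)
    have "(\<Sum>j\<le>Suc m. real j * real (Suc m choose j) * x ^ (Suc m - j))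
        = (\<Sum>i\<le>m. real (Suc i) * real (Suc m choose Suc i) * x ^ (m - i))"
      by (subst sum.atMost_Suc_shift) simp
    also have "\<dots> = (\<Sum>i\<le>m. real (Suc m) * (real (m choose i) * x ^ (m - i)))"
      unfolding of_nat_mult[symmetric] Suc_times_binomial by (simp only: of_nat_mult mult.assoc)
    also have "\<dots> = real (Suc m) * (x + 1) ^ m"
      by (simp only: sum_distrib_left[symmetric] 1)
    finally show ?thesis using Suc by simp
  qed simp
  have "(\<Sum>j\<le>n. real (n choose j) * (c + real j) * x ^ (n - j))
      = c * (\<Sum>j\<le>n. real (n choose j) * x ^ (n - j))
        + (\<Sum>j\<le>n. real j * real (n choose j) * x ^ (n - j))"
    by (simp add: sum_distrib_left sum.distrib[symmetric] algebra_simps)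
  then show ?thesis by (simp add: 1 2)
qed

text \<open>\<open>fact n\<close> times the Taylor polynomial of exp; the scaling absorbs factorials
  of binomial coefficients in the convolution below.\<close>

definition truncated_exp :: "nat \<Rightarrow> real \<Rightarrow> real" where
  "truncated_exp n x = (\<Sum>s\<le>n. fact n / fact s * x ^ s)"

text \<open>Collecting the terms with \<open>j + s = t\<close> leaves the sums of
  \<open>sum_binomial_linear\<close>, weighted by \<open>fact n / fact t\<close>.\<close>

lemma truncated_exp_convolution:
  "(\<Sum>j\<le>n. real (n choose j) * (c + real j) * truncated_exp (n - j) x)
     = (c + 1) * truncated_exp n (x + 1) - (x + 1) ^ n"
proof -
  have "(\<Sum>j\<le>n. real (n choose j) * (c + real j) * truncated_exp (n - j) x)
      = (\<Sum>j\<le>n. \<Sum>s\<le>n - j. fact n / (fact j * fact s) * (c + real j) * x ^ s)"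
    unfolding truncated_exp_def sum_distrib_left
    by (intro sum.cong) (auto simp: binomial_fact)
  also have "\<dots> = (\<Sum>t\<le>n. \<Sum>j\<le>t. fact n / (fact j * fact (t - j)) * (c + real j) * x ^ (t - j))"
  proof -
    have "(SIGMA j:{..n}. {..n - j}) = {(j, s). j + s \<le> n}" by auto
    then show ?thesis
      by (subst sum.Sigma) (simp_all only: sum.triangle_reindex_eq finite_atMost ball_triv simp_thms)
  qed
  also have "\<dots> = (\<Sum>t\<le>n. fact n / fact t *
      (\<Sum>j\<le>t. real (t choose j) * (c + real j) * x ^ (t - j)))"
    unfolding sum_distrib_left by (intro sum.cong) (auto simp: binomial_fact)
  also have "\<dots> = (\<Sum>t\<le>n. c * (fact n / fact t * (x + 1) ^ t)
      + fact n / fact t * (real t * (x + 1) ^ (t - 1)))"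
    unfolding sum_binomial_linear by (simp add: algebra_simps)
  also have "\<dots> = c * truncated_exp n (x + 1)
      + (\<Sum>t\<le>n. fact n / fact t * (real t * (x + 1) ^ (t - 1)))"
    by (simp add: sum.distrib sum_distrib_left truncated_exp_def)
  \<comment> \<open>The left side is the derivative of \<open>truncated_exp n\<close> at
    \<open>x + 1\<close>, which loses only the top term.\<close>
  also have "(\<Sum>t\<le>n. fact n / fact t * (real t * (x + 1) ^ (t - 1)))
      = truncated_exp n (x + 1) - (x + 1) ^ n"
  proof (cases n)
    case (Suc m)
    have "(\<Sum>t\<le>Suc m. fact n / fact t * (real t * (x + 1) ^ (t - 1)))
        = (\<Sum>t\<le>m. fact n / fact t * (x + 1) ^ t)"
      by (subst sum.atMost_Suc_shift) (simp add: field_simps del: of_nat_Suc)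
    then show ?thesis using Suc by (simp add: truncated_exp_def)
  qed (simp add: truncated_exp_def)
  finally show ?thesis by (simp add: algebra_simps)
qed

text \<open>Twice the sum of \<open>f a\<close> over \<open>f \<in> park 0 b A\<close> (defined below), for \<open>card A = n + 1\<close> and
  \<open>x = b + n + 1\<close>; \<open>b\<close> is real because the value at \<open>b = -1\<close> is needed.\<close>

definition first_sum :: "nat \<Rightarrow> real \<Rightarrow> real \<Rightarrow> real" where
  "first_sum n b x = b * (x ^ n * (x + 1) - truncated_exp n x)"

text \<open>The sum mirrors the choice of a set of ones avoiding a fixed argument. The hypothesis on
  \<open>x\<close> enters in the last step, as
  \<open>(b - 1) * (x + 1) + n + 1 = b * x\<close>.\<close>

lemma first_sum_recurrence:
  assumes "x = b + real n"
  shows "(\<Sum>j\<le>n. real (n choose j) * first_sum (n - j) (b + real j - 1) x)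
       = first_sum n b (x + 1) - 2 * b * (x + 1) ^ n"
proof -
  have "(\<Sum>j\<le>n. real (n choose j) * first_sum (n - j) (b + real j - 1) x)
      = (x + 1) * (\<Sum>j\<le>n. real (n choose j) * ((b - 1) + real j) * x ^ (n - j))
        - (\<Sum>j\<le>n. real (n choose j) * ((b - 1) + real j) * truncated_exp (n - j) x)"
    unfolding first_sum_def sum_distrib_left sum_subtractf[symmetric]
    by (intro sum.cong) (auto simp: algebra_simps)
  also have "\<dots> = (b - 1) * (x + 1) * (x + 1) ^ n + real n * ((x + 1) * (x + 1) ^ (n - 1))
      - (b * truncated_exp n (x + 1) - (x + 1) ^ n)"
    unfolding sum_binomial_linear truncated_exp_convolution by (simp add: algebra_simps)
  also have "real n * ((x + 1) * (x + 1) ^ (n - 1)) = real n * (x + 1) ^ n"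
    by (cases n) auto
  finally show ?thesis
    unfolding first_sum_def assms by (simp add: algebra_simps)
qed

section \<open>Generalised parking functions and the removal of ones\<close>

text \<open>Here \<open>l = 0\<close> gives the generalised parking functions (\<open>b = 1\<close> being the classical ones), while
  \<open>l = 1\<close>, \<open>b = 0\<close> gives the prime ones. For \<open>l = 1\<close>, \<open>b = 0\<close> and a singleton \<open>A\<close> the set is empty,
  although there is one prime parking function of length 1.\<close>

definition park :: "nat \<Rightarrow> nat \<Rightarrow> 'a set \<Rightarrow> ('a \<Rightarrow> nat) set" where
  "park l b A = {f \<in> A \<rightarrow>\<^sub>E {1..<b + card A}.
     \<forall>k. l \<le> k \<and> k < b + card A \<longrightarrow> k < b + card {a\<in>A. f a \<le> k}}"

lemma finite_park: "finite A \<Longrightarrow> finite (park l b A)"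
  unfolding park_def by (rule finite_subset[of _ "A \<rightarrow>\<^sub>E {1..<b + card A}"]) (auto intro: finite_PiE)

lemma park_0_eq_park_1: "b > 0 \<Longrightarrow> park 0 b A = park 1 b A"
  unfolding park_def by (auto, metis One_nat_def Suc_leI gr0I trans_less_add1)

lemma park_0_0:
  assumes "finite A" "A \<noteq> {}"
  shows "park 0 0 A = {}"
proof -
  have False if "f \<in> park 0 0 A" for f
  proof -
    have f: "f \<in> A \<rightarrow>\<^sub>E {1..<card A}" using that by (simp add: park_def)
    have "0 < card A" using assms by (simp add: card_gt_0_iff)
    then have "0 < card {a\<in>A. f a \<le> 0}" using that by (auto simp: park_def)
    moreover have "{a\<in>A. f a \<le> 0} = {}" using f by (fastforce simp: PiE_iff)
    ultimately show False by (simp only: card.empty)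
  qed
  then show ?thesis by blast
qed

text \<open>For \<open>b = 0\<close> this rules out \<open>J = {}\<close>, where the parameter
  \<open>b + card J - 1\<close> would be negative.\<close>

lemma park_ones_nonempty:
  assumes "finite A" "A \<noteq> {}" "f \<in> park 1 0 A"
  shows "{a\<in>A. f a = 1} \<noteq> {}"
proof
  assume *: "{a\<in>A. f a = 1} = {}"
  have f: "f \<in> A \<rightarrow>\<^sub>E {1..<card A}" using assms by (simp add: park_def)
  obtain a where "a \<in> A" using assms by auto
  \<comment> \<open>The range \<open>{1..<card A}\<close> contains \<open>f a\<close>, so the
    constraint at \<open>k = 1\<close> is in force.\<close>
  then have "1 < card A" using f by (fastforce simp: PiE_iff)
  then have "1 < card {a\<in>A. f a \<le> 1}" using assms by (auto simp: park_def)
  moreover have "{a\<in>A. f a \<le> 1} = {}" using f * by (fastforce simp: PiE_iff)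
  ultimately show False by (simp only: card.empty not_less_zero)
qed

definition lift_park :: "'a set \<Rightarrow> 'a set \<Rightarrow> ('a \<Rightarrow> nat) \<Rightarrow> 'a \<Rightarrow> nat" where
  "lift_park A J g = (\<lambda>a\<in>A. if a \<in> J then 1 else Suc (g a))"

text \<open>All of \<open>J\<close> is counted at every threshold \<open>Suc k\<close>, so the
  constraint on \<open>f\<close> at \<open>Suc k\<close> is the one on \<open>g\<close> at
  \<open>k\<close> with parameter \<open>b'\<close>; thus \<open>l = 1\<close> becomes
  \<open>l = 0\<close>. The last hypothesis puts the value 1 into the codomain.\<close>

lemma sum_park_fiber:
  fixes h :: "('a \<Rightarrow> nat) \<Rightarrow> real"
  assumes "finite A" "J \<subseteq> A" "b + card J = Suc b'" "A \<noteq> {} \<Longrightarrow> 1 < b + card A"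
  shows "(\<Sum>f | f \<in> park 1 b A \<and> {a\<in>A. f a = 1} = J. h f)
       = (\<Sum>g\<in>park 0 b' (A - J). h (lift_park A J g))"
proof -
  have cA: "card (A - J) = card A - card J" "card J \<le> card A"
    using assms by (auto simp: card_Diff_subset card_mono finite_subset)
  have bA: "b + card A = Suc (b' + card (A - J))" using cA assms(3) by simp
  have count: "b + card {a\<in>A. f a \<le> Suc k} = Suc (b' + card {a\<in>A - J. g a \<le> k})"
    if "\<And>a. a \<in> J \<Longrightarrow> f a = 1" "\<And>a. a \<in> A - J \<Longrightarrow> f a = Suc (g a)" for f g :: "'a \<Rightarrow> nat" and k
  proof -
    have "{a\<in>A. f a \<le> Suc k} = J \<union> {a\<in>A - J. g a \<le> k}" using that assms(2) by force
    moreover have "card (J \<union> {a\<in>A - J. g a \<le> k}) = card J + card {a\<in>A - J. g a \<le> k}"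
      using assms by (intro card_Un_disjoint) (auto intro: finite_subset)
    ultimately show ?thesis using assms(3) by simp
  qed
  have cond: "(\<forall>k. 1 \<le> k \<and> k < b + card A \<longrightarrow> k < b + card {a\<in>A. f a \<le> k}) \<longleftrightarrow>
      (\<forall>k. 0 \<le> k \<and> k < b' + card (A - J) \<longrightarrow> k < b' + card {a\<in>A - J. g a \<le> k})"
    if "\<And>a. a \<in> J \<Longrightarrow> f a = 1" "\<And>a. a \<in> A - J \<Longrightarrow> f a = Suc (g a)" for f g :: "'a \<Rightarrow> nat"
  proof -
    have "(\<forall>k. 1 \<le> k \<and> k < b + card A \<longrightarrow> k < b + card {a\<in>A. f a \<le> k}) \<longleftrightarrow>
      (\<forall>k. Suc k < b + card A \<longrightarrow> Suc k < b + card {a\<in>A. f a \<le> Suc k})"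
      by (auto simp: Suc_le_eq gr0_conv_Suc)
    then show ?thesis by (simp only: count[of f g, OF that] bA Suc_less_eq) simp
  qed
  show ?thesis
  proof (rule sum.reindex_bij_witness[where i = "lift_park A J" and j = "\<lambda>f. \<lambda>a\<in>A - J. f a - 1"],
      goal_cases)
    case (1 f)
    have "f \<in> A \<rightarrow>\<^sub>E {1..<b + card A}" "J = {a\<in>A. f a = 1}" using 1 by (auto simp: park_def)
    then show ?case
      by (auto simp: lift_park_def fun_eq_iff PiE_iff extensional_def)
  next
    case (2 f)
    have f: "f \<in> A \<rightarrow>\<^sub>E {1..<b + card A}" and J: "J = {a\<in>A. f a = 1}"
      using 2 by (auto simp: park_def)
    let ?g = "\<lambda>a\<in>A - J. f a - 1"
    have *: "f a = 1" if "a \<in> J" for a using that J by auto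
    have **: "f a = Suc (?g a)" "f a \<noteq> 1" if "a \<in> A - J" for a
      using that f J by (auto simp: PiE_iff)
    have "?g \<in> (A - J) \<rightarrow>\<^sub>E {1..<b' + card (A - J)}"
    proof (rule PiE_I)
      fix a assume a: "a \<in> A - J"
      then have "f a < b + card A" using f by (auto simp: PiE_iff)
      then show "?g a \<in> {1..<b' + card (A - J)}" using **[OF a] bA by auto
    qed auto
    then show ?case using 2 cond[of f ?g, OF * **(1)] by (simp add: park_def)
  next
    case (3 g)
    then show ?case
      by (auto simp: lift_park_def fun_eq_iff park_def PiE_iff extensional_def)
  next
    case (4 g)
    have g: "g \<in> (A - J) \<rightarrow>\<^sub>E {1..<b' + card (A - J)}" using 4 by (simp add: park_def)
    let ?f = "lift_park A J g"
    have *: "?f a = 1" if "a \<in> J" for a using that assms by (auto simp: lift_park_def)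
    have **: "?f a = Suc (g a)" "1 \<le> g a" "g a < b' + card (A - J)" if "a \<in> A - J" for a
      using that g by (auto simp: PiE_iff lift_park_def)
    have "?f \<in> A \<rightarrow>\<^sub>E {1..<b + card A}"
    proof (rule PiE_I)
      fix a assume a: "a \<in> A"
      show "?f a \<in> {1..<b + card A}"
      proof -
        have "1 < b + card A" using assms(4) a by blast
        then show ?thesis using a *[of a] **[of a] bA by (cases "a \<in> J") auto
      qed
    qed (auto simp: lift_park_def)
    moreover have "{a\<in>A. ?f a = 1} = J"
    proof
      show "{a\<in>A. ?f a = 1} \<subseteq> J"
      proof
        fix a assume "a \<in> {a\<in>A. ?f a = 1}"
        then show "a \<in> J" using **[of a] by (cases "a \<in> J") auto
      qed
      show "J \<subseteq> {a\<in>A. ?f a = 1}" using * assms(2) by blast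
    qed
    ultimately show ?case using 4 cond[of ?f g, OF * **(1)] by (simp add: park_def)
  next
    case (5 f)
    then have "lift_park A J (\<lambda>a\<in>A - J. f a - 1) = f"
      by (auto simp: lift_park_def fun_eq_iff park_def PiE_iff extensional_def)
    then show ?case by simp
  qed
qed

text \<open>Groups by the set \<open>J\<close> of ones. The zero branch is the empty fiber
  \<open>b = 0\<close>, \<open>J = {}\<close>. The last hypothesis excludes
  \<open>park 1 0 {}\<close>, whose single element has no ones.\<close>

lemma sum_park_step:
  fixes h :: "('a \<Rightarrow> nat) \<Rightarrow> real"
  assumes A: "finite A" "A \<noteq> {} \<Longrightarrow> 1 < b + card A" and b: "b > 0 \<or> A \<noteq> {}"
  shows "(\<Sum>f\<in>park 1 b A. h f)
       = (\<Sum>J\<in>Pow A. if b + card J = 0 then 0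
            else \<Sum>g\<in>park 0 (b + card J - 1) (A - J). h (lift_park A J g))"
proof -
  have "(\<Sum>f\<in>park 1 b A. h f) =
      (\<Sum>J\<in>Pow A. \<Sum>f | f \<in> park 1 b A \<and> {a\<in>A. f a = 1} = J. h f)"
    using A by (intro sum.group[symmetric]) (auto intro: finite_park)
  also have "\<dots> = (\<Sum>J\<in>Pow A. if b + card J = 0 then 0
            else \<Sum>g\<in>park 0 (b + card J - 1) (A - J). h (lift_park A J g))"
  proof (rule sum.cong[OF refl])
    fix J assume J: "J \<in> Pow A"
    show "(\<Sum>f | f \<in> park 1 b A \<and> {a\<in>A. f a = 1} = J. h f) = (if b + card J = 0 then 0
            else \<Sum>g\<in>park 0 (b + card J - 1) (A - J). h (lift_park A J g))"
    proof (cases "b + card J = 0")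
      case True
      then have "b = 0" "J = {}" using J A by (auto simp: finite_subset)
      then have "{f. f \<in> park 1 b A \<and> {a\<in>A. f a = 1} = J} = {}"
        using park_ones_nonempty[OF A(1)] b by blast
      then show ?thesis using True by (simp only: if_True sum.empty refl)
    next
      case False
      then show ?thesis
        using sum_park_fiber[OF A(1) _ _ A(2), of J "b + card J - 1" h] J by auto
    qed
  qed
  finally show ?thesis .
qed

section \<open>Number of functions and sum of values for \<open>l = 0\<close>\<close>

text \<open>The factor on the left avoids the exponent \<open>card A - 1\<close>, so that empty
  \<open>A\<close> is covered. The induction is on \<open>b + card A\<close>, which drops by 1 for
  every \<open>J\<close>.\<close>

lemma card_park_0:
  assumes "finite A"
  shows "real (b + card A) * real (card (park 0 b A)) = real b * real (b + card A) ^ card A"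
  using assms
proof (induction "b + card A" arbitrary: b A)
  case 0
  then show ?case by simp
next
  case (Suc N)
  consider "b = 0" | "A = {}" | "b > 0" "A \<noteq> {}" by auto
  then show ?case
  proof cases
    case 1
    then show ?thesis using park_0_0[of A] Suc by (cases "A = {}") auto
  next
    case 2
    then have "park 0 b A = {\<lambda>_. undefined}" by (auto simp: park_def)
    then show ?thesis using 2 by simp
  next
    case 3
    define n where "n = card A"
    have n: "n > 0" using 3 Suc by (simp add: n_def card_gt_0_iff)
    have N: "b + n = Suc N" "N > 0" using Suc 3 n by (auto simp: n_def)
    have IH: "real N * real (card (park 0 (b + card J - 1) (A - J)))
        = (real b - 1 + real (card J)) * real N ^ (n - card J)" if "J \<in> Pow A" for J
    proof -
      have c: "card (A - J) = n - card J" "card J \<le> n"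
        using that Suc unfolding n_def by (auto simp: card_Diff_subset card_mono finite_subset)
      have "N = (b + card J - 1) + card (A - J)" using c N 3 by simp
      from Suc(1)[OF this] this c Suc 3 show ?thesis by (simp add: of_nat_diff)
    qed
    have "real (card (park 0 b A)) = (\<Sum>f\<in>park 1 b A. 1)"
      using 3 by (simp add: park_0_eq_park_1)
    also have "\<dots> = (\<Sum>J\<in>Pow A. real (card (park 0 (b + card J - 1) (A - J))))"
      using 3 Suc N n by (subst sum_park_step) (auto simp: n_def intro!: sum.cong)
    \<comment> \<open>The factor \<open>N\<close> brings each summand into the form of the induction
      hypothesis.\<close>
    finally have "real N * real (card (park 0 b A))
        = (\<Sum>J\<in>Pow A. real N * real (card (park 0 (b + card J - 1) (A - J))))"
      by (simp add: sum_distrib_left)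
    also have "\<dots> = (\<Sum>J\<in>Pow A. (real b - 1 + real (card J)) * real N ^ (n - card J))"
      using IH by (intro sum.cong) auto
    also have "\<dots> = (\<Sum>j\<le>n. real (n choose j) * ((real b - 1 + real j) * real N ^ (n - j)))"
      unfolding n_def by (rule sum_Pow_card) fact
    also have "\<dots> = (real b - 1) * (real N + 1) ^ n + real n * (real N + 1) ^ (n - 1)"
      using sum_binomial_linear[of n "real b - 1" "real N"] by (simp add: mult.assoc)
    also have "\<dots> = ((real b - 1) * (real N + 1) + real n) * (real N + 1) ^ (n - 1)"
      using n by (cases n) (auto simp: algebra_simps)
    \<comment> \<open>By \<open>b + n = N + 1\<close> a factor \<open>N\<close> splits off and
      cancels.\<close>
    also have "(real b - 1) * (real N + 1) + real n = real N * real b"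
    proof -
      have "real n = real N + 1 - real b" using N by linarith
      then show ?thesis by (simp add: algebra_simps)
    qed
    finally have "real (card (park 0 b A)) = real b * (real N + 1) ^ (n - 1)"
      using N by simp
    moreover have "(real N + 1) * (real N + 1) ^ (n - 1) = (real N + 1) ^ n"
      using n by (cases n) auto
    moreover have "real (b + card A) = real N + 1" using N by (simp add: n_def)
    ultimately show ?thesis by (simp add: n_def[symmetric] mult.left_commute)
  qed
qed

text \<open>Write \<open>f a = 1 + (f a - 1)\<close>: the second part is 0 if \<open>a\<close> lies
  in \<open>J\<close>, and \<open>g a\<close> otherwise.\<close>

lemma sum_park_1_apply:
  assumes A: "finite A" "1 < b + card A" and a: "a \<in> A"
  shows "(\<Sum>f\<in>park 1 b A. real (f a)) = real (card (park 1 b A))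
       + (\<Sum>J\<in>Pow (A - {a}). if b + card J = 0 then 0
            else \<Sum>g\<in>park 0 (b + card J - 1) (A - J). real (g a))"
proof -
  have "f a \<ge> 1" if "f \<in> park 1 b A" for f
    using that a by (auto simp: park_def PiE_iff)
  then have "(\<Sum>f\<in>park 1 b A. real (f a)) = (\<Sum>f\<in>park 1 b A. 1 + real (f a - 1))"
    by (intro sum.cong) (auto simp: of_nat_diff)
  also have "\<dots> = real (card (park 1 b A)) + (\<Sum>f\<in>park 1 b A. real (f a - 1))"
    by (simp add: sum.distrib)
  also have "(\<Sum>f\<in>park 1 b A. real (f a - 1)) = (\<Sum>J\<in>Pow A. if b + card J = 0 then 0
            else \<Sum>g\<in>park 0 (b + card J - 1) (A - J). real (lift_park A J g a - 1))"
    using a by (intro sum_park_step A) auto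
  also have "\<dots> = (\<Sum>J\<in>Pow (A - {a}). if b + card J = 0 then 0
            else \<Sum>g\<in>park 0 (b + card J - 1) (A - J). real (lift_park A J g a - 1))"
    using A a by (intro sum.mono_neutral_right) (auto simp: lift_park_def)
  also have "\<dots> = (\<Sum>J\<in>Pow (A - {a}). if b + card J = 0 then 0
            else \<Sum>g\<in>park 0 (b + card J - 1) (A - J). real (g a))"
  proof -
    have "lift_park A J g a - 1 = g a" if "J \<in> Pow (A - {a})" for J g
      using that a by (auto simp: lift_park_def)
    then show ?thesis by (intro sum.cong refl if_cong) auto
  qed
  finally show ?thesis .
qed

text \<open>Induction on \<open>b + n\<close>. Twice the number of functions,
  \<open>2 * b * (x + 1) ^ n\<close>, cancels the term subtracted in
  \<open>first_sum_recurrence\<close>.\<close>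

lemma sum_park_0_apply:
  assumes "finite A" "card A = Suc n" "a \<in> A"
  shows "2 * (\<Sum>f\<in>park 0 b A. real (f a)) = first_sum n (real b) (real (b + n) + 1)"
  using assms
proof (induction "b + n" arbitrary: b A n)
  case 0
  then have "park 0 b A = {}" using park_0_0[of A] by fastforce
  then show ?case using 0 by (simp add: first_sum_def)
next
  case (Suc N)
  show ?case
  proof (cases "b = 0")
    case True
    then have "park 0 b A = {}" using park_0_0[of A] Suc by fastforce
    then show ?thesis using True by (simp add: first_sum_def)
  next
    case False
    define x where "x = real (b + n)"
    have x: "x = real b + real n" "real N + 1 = x" using Suc(2) by (auto simp: x_def)
    have "(x + 1) * real (card (park 0 b A)) = (x + 1) * (real b * (x + 1) ^ n)"
      using card_park_0[of A b] Suc(3,4) by (simp add: x_def algebra_simps)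
    then have card: "real (card (park 0 b A)) = real b * (x + 1) ^ n"
      by (simp add: x_def)
    have IH: "2 * (\<Sum>g\<in>park 0 (b + card J - 1) (A - J). real (g a))
        = first_sum (n - card J) (real b + real (card J) - 1) x" if "J \<in> Pow (A - {a})" for J
    proof -
      have "card J \<le> card (A - {a})" using that Suc by (intro card_mono) auto
      then have "card J \<le> n" using Suc by simp
      moreover from this have "card (A - J) = Suc (n - card J)"
        using that Suc by (subst card_Diff_subset) (auto intro: finite_subset[of _ A])
      moreover have "N = (b + card J - 1) + (n - card J)"
        using \<open>card J \<le> n\<close> Suc(2) False by simp
      ultimately show ?thesis
        using Suc(1)[of "b + card J - 1" "n - card J" "A - J"] Suc that False
        by (auto simp: of_nat_diff x(2)[symmetric])
    qed
    have "(\<Sum>f\<in>park 0 b A. real (f a)) = real (card (park 0 b A))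
       + (\<Sum>J\<in>Pow (A - {a}). \<Sum>g\<in>park 0 (b + card J - 1) (A - J). real (g a))"
      using sum_park_1_apply[of A b a] False Suc by (simp add: park_0_eq_park_1)
    then have "2 * (\<Sum>f\<in>park 0 b A. real (f a)) = 2 * real b * (x + 1) ^ n
       + (\<Sum>J\<in>Pow (A - {a}). 2 * (\<Sum>g\<in>park 0 (b + card J - 1) (A - J). real (g a)))"
      by (simp add: card sum_distrib_left)
    also have "(\<Sum>J\<in>Pow (A - {a}). 2 * (\<Sum>g\<in>park 0 (b + card J - 1) (A - J). real (g a)))
       = (\<Sum>J\<in>Pow (A - {a}). first_sum (n - card J) (real b + real (card J) - 1) x)"
      using IH by (intro sum.cong) auto
    also have "\<dots> = (\<Sum>j\<le>n. real (n choose j) * first_sum (n - j) (real b + real j - 1) x)"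
      using sum_Pow_card[of "A - {a}" "\<lambda>j. first_sum (n - j) (real b + real j - 1) x"] Suc
      by simp
    also have "\<dots> = first_sum n (real b) (x + 1) - 2 * real b * (x + 1) ^ n"
      by (rule first_sum_recurrence) (fact x)
    finally show ?thesis by (simp add: x_def)
  qed
qed

section \<open>The prime case \<open>l = 1\<close>, \<open>b = 0\<close>\<close>

text \<open>The full binomial sum with \<open>c = - 1\<close>, \<open>x = n\<close> is 0; its term
  at \<open>j = 0\<close>, absent here because a one always occurs, is
  \<open>- (n ^ Suc n)\<close>.\<close>

lemma card_park_1_0:
  assumes A: "finite A" "card A = Suc n" and n: "n > 0"
  shows "real (card (park 1 0 A)) = real n ^ n"
proof -
  let ?g = "\<lambda>j. (if j = 0 then 0 else (real j - 1) * real n ^ (Suc n - j))"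
  have c: "real n * real (card (park 0 (card J - 1) (A - J)))
      = (real (card J) - 1) * real n ^ (Suc n - card J)"
    if "J \<in> Pow A" "card J \<noteq> 0" for J
  proof -
    have "card (A - J) = Suc n - card J" "card J \<le> Suc n"
      using that A by (auto simp: card_Diff_subset card_mono finite_subset simp flip: A(2))
    moreover from this have "card J - 1 + card (A - J) = n" using that by simp
    ultimately show ?thesis
      using card_park_0[of "A - J" "card J - 1"] A that by (simp add: of_nat_diff)
  qed
  have "real n * real (card (park 1 0 A)) = real n * (\<Sum>f\<in>park 1 0 A. 1)"
    by simp
  also have "\<dots> = (\<Sum>J\<in>Pow A. real n * (if 0 + card J = 0 then 0
      else real (card (park 0 (0 + card J - 1) (A - J)))))"
    using A n unfolding sum_distrib_left[symmetric]
    by (subst sum_park_step) (auto intro!: sum.cong arg_cong[where f = "(*) (real n)"])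
  also have "\<dots> = (\<Sum>J\<in>Pow A. ?g (card J))"
    using c by (intro sum.cong) auto
  also have "\<dots> = (\<Sum>j\<le>Suc n. real (Suc n choose j) * ?g j)"
    using sum_Pow_card[OF A(1), of ?g] A by simp
  also have "\<dots> = (\<Sum>j\<le>Suc n. real (Suc n choose j) * ((- 1) + real j) * real n ^ (Suc n - j))
      + real n ^ Suc n"
    by (subst (1 2) sum.atMost_Suc_shift) (simp add: mult.assoc)
  also have "\<dots> = real n * real n ^ n"
    by (subst sum_binomial_linear) (simp add: algebra_simps)
  finally show ?thesis using n by simp
qed

text \<open>At \<open>b = 0\<close> the right side of \<open>first_sum_recurrence\<close> vanishes,
  so the terms with \<open>j > 0\<close> sum to \<open>- first_sum n (- 1) n\<close>; counting the
  functions adds \<open>2 * n ^ n\<close>.\<close>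

lemma sum_park_1_0_apply:
  assumes A: "finite A" "card A = Suc n" and n: "n > 0" and a: "a \<in> A"
  shows "2 * (\<Sum>f\<in>park 1 0 A. real (f a)) = (real n + 3) * real n ^ n - truncated_exp n (real n)"
proof -
  let ?g = "\<lambda>j. if j = 0 then 0 else first_sum (n - j) (0 + real j - 1) (real n)"
  have c: "2 * (\<Sum>g\<in>park 0 (card J - 1) (A - J). real (g a)) = ?g (card J)"
    if "J \<in> Pow (A - {a})" "card J \<noteq> 0" for J
  proof -
    have "card J \<le> card (A - {a})" using that A by (intro card_mono) auto
    then have J: "card J \<le> n" using A a by simp
    moreover from this have "card (A - J) = Suc (n - card J)"
      using that A by (subst card_Diff_subset) (auto intro: finite_subset[of _ A])
    moreover have "real (card J - 1 + (n - card J)) + 1 = real n"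
      using that(2) J by linarith
    ultimately show ?thesis
      using sum_park_0_apply[of "A - J" "n - card J" a "card J - 1"] A a that
      by (auto simp: of_nat_diff simp del: of_nat_add)
  qed
  have "2 * (\<Sum>f\<in>park 1 0 A. real (f a)) = 2 * real n ^ n
      + (\<Sum>J\<in>Pow (A - {a}). 2 * (if 0 + card J = 0 then 0
            else \<Sum>g\<in>park 0 (0 + card J - 1) (A - J). real (g a)))"
    using A n a
    by (subst sum_park_1_apply) (auto simp: card_park_1_0[OF A n, simplified] sum_distrib_left)
  also have "(\<Sum>J\<in>Pow (A - {a}). 2 * (if 0 + card J = 0 then 0
            else \<Sum>g\<in>park 0 (0 + card J - 1) (A - J). real (g a)))
      = (\<Sum>J\<in>Pow (A - {a}). ?g (card J))"
    using c by (intro sum.cong) auto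
  also have "\<dots> = (\<Sum>j\<le>n. real (n choose j) * ?g j)"
    using sum_Pow_card[of "A - {a}" ?g] A a by simp
  also have "\<dots> = (\<Sum>j\<le>n. real (n choose j) * first_sum (n - j) (0 + real j - 1) (real n))
      - first_sum n (- 1) (real n)"
    by (simp add: sum.atMost_shift)
  also have "\<dots> = - first_sum n (- 1) (real n)"
    by (subst first_sum_recurrence) (auto simp: first_sum_def)
  finally show ?thesis by (simp add: first_sum_def algebra_simps)
qed

section \<open>From functions back to lists\<close>

definition count_le :: "nat \<Rightarrow> nat list \<Rightarrow> nat" where
  "count_le k xs = length (filter (\<lambda>x. x \<le> k) xs)"

text \<open>In a sorted list the entries at most \<open>k\<close> form a prefix.\<close>

lemma sorted_nth_le_iff:
  assumes "sorted xs" "i < length xs"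
  shows "xs ! i \<le> k \<longleftrightarrow> i < count_le k xs"
  using assms
proof (induction xs arbitrary: i)
  case (Cons x xs)
  show ?case
  proof (cases "x \<le> k")
    case True
    then show ?thesis using Cons by (cases i) (auto simp: count_le_def)
  next
    case False
    then have "filter (\<lambda>x. x \<le> k) xs = []" using Cons by (auto simp: filter_empty_conv)
    moreover have "x \<le> (x # xs) ! i" using Cons by (cases i) auto
    ultimately show ?thesis using False by (auto simp: count_le_def)
  qed
qed simp

text \<open>Replaces order statistics by counts, with \<open>k = i + 1\<close>, so that removing an
  entry involves no sorting.\<close>

lemma parking_functions_iff:
  "\<pi> \<in> parking_functions n \<longleftrightarrow> length \<pi> = n \<and> (\<forall>x\<in>set \<pi>. 1 \<le> x) \<and>
     (\<forall>k. 1 \<le> k \<and> k \<le> n \<longrightarrow> k \<le> count_le k \<pi>)"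
proof -
  have "count_le k (sort \<pi>) = count_le k \<pi>" for k
    unfolding count_le_def by (metis filter_sort length_sort)
  then have "(\<forall>i<n. sort \<pi> ! i \<le> i + 1) \<longleftrightarrow> (\<forall>i<n. i < count_le (i + 1) \<pi>)" if "length \<pi> = n"
    using that sorted_nth_le_iff[of "sort \<pi>"] by simp
  also have "(\<forall>i<n. i < count_le (i + 1) \<pi>) \<longleftrightarrow> (\<forall>k. 1 \<le> k \<and> k \<le> n \<longrightarrow> k \<le> count_le k \<pi>)"
    by (metis Suc_eq_plus1 Suc_le_eq Suc_le_D One_nat_def le_add2)
  finally show ?thesis unfolding parking_functions_def by auto
qed

lemma count_le_remove_nth:
  assumes "i < length \<pi>" "\<pi> ! i = 1" "1 \<le> k"
  shows "count_le k \<pi> = Suc (count_le k (remove_nth i \<pi>))"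
proof -
  have "\<pi> = take i \<pi> @ \<pi> ! i # drop (Suc i) \<pi>" using assms(1) by (rule id_take_nth_drop)
  then have "count_le k \<pi> = count_le k (take i \<pi> @ \<pi> ! i # drop (Suc i) \<pi>)" by simp
  then show ?thesis using assms by (simp add: count_le_def remove_nth_def)
qed

text \<open>Removing a 1 lowers every count with \<open>k \<ge> 1\<close> by one, which makes the
  inequalities strict. The bound \<open>x \<le> n\<close> is the case \<open>k = n\<close>, as there
  are only \<open>n + 1\<close> entries.\<close>

lemma prime_parking_functions_iff:
  assumes "n > 0"
  shows "\<pi> \<in> prime_parking_functions (n + 1) \<longleftrightarrow>
     length \<pi> = n + 1 \<and> (\<forall>x\<in>set \<pi>. 1 \<le> x \<and> x \<le> n) \<and>
     (\<forall>k. 1 \<le> k \<and> k \<le> n \<longrightarrow> k < count_le k \<pi>)" (is "_ \<longleftrightarrow> ?R")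
proof
  assume "\<pi> \<in> prime_parking_functions (n + 1)"
  then have \<pi>: "\<pi> \<in> parking_functions (n + 1)"
    and rem: "\<And>i. i < n + 1 \<Longrightarrow> \<pi> ! i = 1 \<Longrightarrow> remove_nth i \<pi> \<in> parking_functions n"
    by (auto simp: prime_parking_functions_def)
  \<comment> \<open>The constraint at \<open>k = 1\<close> yields an entry 1, without which the
    removal condition would be vacuous.\<close>
  from \<pi> have len: "length \<pi> = n + 1" and pos: "\<forall>x\<in>set \<pi>. 1 \<le> x" and "1 \<le> count_le 1 \<pi>"
    by (auto simp: parking_functions_iff)
  then have "filter (\<lambda>x. x \<le> 1) \<pi> \<noteq> []" by (auto simp: count_le_def)
  then obtain x where "x \<in> set \<pi>" "x \<le> 1" by (auto simp: filter_empty_conv)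
  then have "1 \<in> set \<pi>" using pos by (metis le_antisym)
  then obtain i where i: "i < n + 1" "\<pi> ! i = 1" using len by (metis in_set_conv_nth)
  have cnt: "\<forall>k. 1 \<le> k \<and> k \<le> n \<longrightarrow> k < count_le k \<pi>"
    using rem[OF i] count_le_remove_nth[of i \<pi>] i len by (auto simp: parking_functions_iff)
  then have "length \<pi> \<le> length (filter (\<lambda>x. x \<le> n) \<pi>)"
    using assms len by (auto simp: count_le_def Suc_le_eq)
  then have "\<forall>x\<in>set \<pi>. x \<le> n" by (metis leD length_filter_less)
  then show ?R using len pos cnt by auto
next
  assume R: ?R
  \<comment> \<open>Supplies the constraint at \<open>k = n + 1\<close>, which \<open>?R\<close>
    does not list.\<close>
  then have "count_le (n + 1) \<pi> = n + 1"
    unfolding count_le_def by (subst filter_True) auto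
  then have "\<pi> \<in> parking_functions (n + 1)"
    using R by (auto simp: parking_functions_iff le_Suc_eq less_imp_le)
  moreover have "remove_nth i \<pi> \<in> parking_functions n" if "i < n + 1" "\<pi> ! i = 1" for i
  proof -
    have "length (remove_nth i \<pi>) = n" "set (remove_nth i \<pi>) \<subseteq> set \<pi>"
      using R that by (auto simp: remove_nth_def dest: in_set_takeD in_set_dropD)
    then show ?thesis
      using R that count_le_remove_nth[of i \<pi>] unfolding parking_functions_iff by fastforce
  qed
  ultimately show "\<pi> \<in> prime_parking_functions (n + 1)"
    by (simp add: prime_parking_functions_def)
qed

text \<open>For \<open>b = 0\<close>, \<open>card A = n + 1\<close> the conditions of
  \<open>park 1 0\<close> are those of \<open>prime_parking_functions_iff\<close>; extensionality
  makes a function recoverable from its list of values.\<close>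

lemma bij_betw_park_prime_parking_functions:
  assumes "n > 0"
  shows "bij_betw (\<lambda>f. map f [0..<n + 1]) (park 1 0 {..<n + 1}) (prime_parking_functions (n + 1))"
proof (rule bij_betw_byWitness[where f' = "\<lambda>\<pi>. \<lambda>i\<in>{..<n + 1}. \<pi> ! i"])
  have cnt: "count_le k (map f [0..<n + 1]) = card {a\<in>{..<n + 1}. f a \<le> k}" for f k
  proof -
    have "count_le k (map f [0..<n + 1]) = length (filter (\<lambda>a. f a \<le> k) [0..<n + 1])"
      by (simp only: count_le_def filter_map o_def length_map)
    also have "\<dots> = card (set (filter (\<lambda>a. f a \<le> k) [0..<n + 1]))"
      by (rule distinct_card[symmetric]) (simp only: distinct_filter distinct_upt)
    also have "set (filter (\<lambda>a. f a \<le> k) [0..<n + 1]) = {a\<in>{..<n + 1}. f a \<le> k}"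
      by (auto simp del: upt_Suc)
    finally show ?thesis .
  qed
  have mem: "map f [0..<n + 1] \<in> prime_parking_functions (n + 1) \<longleftrightarrow> f \<in> park 1 0 {..<n + 1}"
    if "f \<in> extensional {..<n + 1}" for f
    using that unfolding prime_parking_functions_iff[OF assms] cnt park_def PiE_iff
    by (auto simp del: upt_Suc simp: less_Suc_eq_le)
  have inv: "map (\<lambda>i\<in>{..<n + 1}. \<pi> ! i) [0..<n + 1] = \<pi>" if "length \<pi> = n + 1" for \<pi> :: "nat list"
    using that by (auto intro!: nth_equalityI simp del: upt_Suc)
  show "\<forall>f\<in>park 1 0 {..<n + 1}. (\<lambda>i\<in>{..<n + 1}. map f [0..<n + 1] ! i) = f"
    by (auto simp: park_def PiE_iff extensional_def fun_eq_iff simp del: upt_Suc)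
  show *: "\<forall>\<pi>\<in>prime_parking_functions (n + 1). map (\<lambda>i\<in>{..<n + 1}. \<pi> ! i) [0..<n + 1] = \<pi>"
    using inv prime_parking_functions_iff[OF assms] by blast
  show "(\<lambda>f. map f [0..<n + 1]) ` park 1 0 {..<n + 1} \<subseteq> prime_parking_functions (n + 1)"
    using mem by (auto simp: park_def PiE_iff)
  show "(\<lambda>\<pi>. \<lambda>i\<in>{..<n + 1}. \<pi> ! i) ` prime_parking_functions (n + 1) \<subseteq> park 1 0 {..<n + 1}"
  proof (rule image_subsetI)
    fix \<pi> assume \<pi>: "\<pi> \<in> prime_parking_functions (n + 1)"
    have "map (\<lambda>i\<in>{..<n + 1}. \<pi> ! i) [0..<n + 1] \<in> prime_parking_functions (n + 1)"
      using bspec[OF * \<pi>] \<pi> by (simp only:)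
    then show "(\<lambda>i\<in>{..<n + 1}. \<pi> ! i) \<in> park 1 0 {..<n + 1}"
      by (subst (asm) mem) auto
  qed
qed

lemma prime_parking_functions_1: "prime_parking_functions 1 = {[1]}"
proof -
  have "\<pi> \<in> prime_parking_functions 1 \<longleftrightarrow> \<pi> = [1]" for \<pi>
    by (auto simp: prime_parking_functions_def parking_functions_def remove_nth_def length_Suc_conv)
  then show ?thesis by blast
qed

theorem theorem1p1:
  fixes n :: nat
  shows "measure_pmf.expectation (pmf_of_set (prime_parking_functions (n + 1)))
           (\<lambda>\<pi>. real (\<pi> ! 0)) =
         1 / 2 * (real n + 3 - fact n / real n ^ n * (\<Sum>s=0..n. real n ^ s / fact s))"
proof (cases "n = 0")
  case True
  \<comment> \<open>With \<open>0 ^ 0 = 1\<close> the formula gives 1, the entry of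
    \<open>[1]\<close>.\<close>
  then show ?thesis
    using prime_parking_functions_1 by (simp add: integral_pmf_of_set)
next
  case False
  then have n: "n > 0" by simp
  note bij = bij_betw_park_prime_parking_functions[OF n]
  let ?A = "{..<n + 1}" and ?P = "prime_parking_functions (n + 1)"
  have card: "real (card ?P) = real n ^ n"
    using card_park_1_0[of ?A n] n bij_betw_same_card[OF bij] by simp
  \<comment> \<open>Positive \<open>card\<close> also gives finiteness, since infinite sets have
    \<open>card\<close> 0.\<close>
  then have P: "finite ?P" "?P \<noteq> {}"
    using n by (auto intro: card_ge_0_finite simp: card_gt_0_iff zero_less_power)
  have "(\<Sum>\<pi>\<in>?P. real (\<pi> ! 0)) = (\<Sum>f\<in>park 1 0 ?A. real (map f [0..<n + 1] ! 0))"
    by (rule sum.reindex_bij_betw[OF bij, symmetric])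
  also have "\<dots> = (\<Sum>f\<in>park 1 0 ?A. real (f 0))"
    by (simp del: upt_Suc)
  also have "\<dots> = 1 / 2 * ((real n + 3) * real n ^ n - truncated_exp n (real n))"
    using sum_park_1_0_apply[of ?A n 0] n by simp
  finally have "measure_pmf.expectation (pmf_of_set ?P) (\<lambda>\<pi>. real (\<pi> ! 0))
      = 1 / 2 * ((real n + 3) * real n ^ n - truncated_exp n (real n)) / real n ^ n"
    using P card by (subst integral_pmf_of_set) (simp_all only: simp_thms)
  also have "\<dots> = 1 / 2 * (real n + 3 - truncated_exp n (real n) / real n ^ n)"
    using n by (simp add: field_simps)
  also have "truncated_exp n (real n) / real n ^ n
      = fact n / real n ^ n * (\<Sum>s=0..n. real n ^ s / fact s)"
    by (simp add: truncated_exp_def sum_distrib_left sum_divide_distrib atMost_atLeast0 mult.commute)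
  finally show ?thesis .
qed

end
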